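(* Let $$B_\infty=\forall X\,\forall Y\,\{(X\to Y),(Y\to X)\to [(X\to Y)\wedge(Y\to X)]\},$$ and for $(i,j)\in\mathbb{N}^2$ let $$T_{i,j}=\lambda x\,\lambda y\,\big\langle \lambda u\,[(x)(y)]^i(x)u,\;\lambda u\,[(y)(x)]^j(y)u\big\rangle .$$ Then $B_\infty$ is an infinite $I$-type, and $\Lambda(B_\infty)=\{T_{i,j}\;;\;(i,j)\in\mathbb{N}^2\}$.
   Context: $\lambda$-terms are untyped; $(t)u$ denotes application and $(t)u_1\dots u_n$ denotes $(\dots((t)u_1)\dots)u_n$. The set of $\lambda I$-terms is defined inductively: variables are $\lambda I$-terms; if $u,v$ are $\lambda I$-terms so is $(u)v$; if $u$ is a $\lambda I$-term and $x$ is free in $u$ then $\lambda x\,u$ is a $\lambda I$-term. System $\mathcal{F}$ (Curry style). Types are built from type variables $X,Y,\dots$ by $E\to F$ and $\forall X\,E$, and are identified up to renaming of bound variables. Typing rules: (ax) $x_1:A_1,\dots,x_n:A_n\vdash x_i:A_i$; ($\to_i$) from $\Gamma,x:A\vdash t:B$ infer $\Gamma\vdash\lambda x\,t:A\to B$; ($\to_e$) from $\Gamma\vdash u:A\to B$ and $\Gamma\vdash v:A$ infer $\Gamma\vdash (u)v:B$; ($\forall_i$) from $\Gamma\vdash t:A$ with $X$ not free in $\Gamma$ infer $\Gamma\vdash t:\forall X A$; ($\forall_e$) from $\Gamma\vdash t:\forall XA$ infer $\Gamma\vdash t:A[G/X]$ for any type $G$. Derivability is written $\Gamma\vdash_{\mathcal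 F}t:A$. Standing convention: only proper types are used, also inside derivations; a type is proper if for each of its subtypes $\forall X E$ the variable $X$ is free in $E$. Notation: $A_1,\dots,A_k\to A$ means $A_1\to(A_2\to\dots(A_k\to A)\dots)$; $A\wedge B=\forall Z\{(A\to(B\to Z))\to Z\}$ with $Z$ not occurring in $A,B$; $\langle u,v\rangle=\lambda k\,(k)uv$ with $k$ not free in $u,v$. For variables $x,y,z$ and $n\in\mathbb{N}$, $\lambda u\,[(x)(y)]^n(z)u$ denotes the $\beta\eta$-normal form of $\lambda u\,(x)(y)\dots(x)(y)(z)u$ with $(x)(y)$ repeated $n$ times, where $(x)(y)w$ means $x$ applied to ($y$ applied to $w$); for $n=0$ it is the $\eta$-reduct $z$. A closed type $D$ is an $I$-type if every closed $\beta$-normal $\lambda$-term $t$ with $\vdash_{\mathcal F}t:D$ is a $\lambda I$-term. $\Lambda(D)$ is the set of closed $\beta\eta$-normal $\lambda$-terms $t$ (up to $\alpha$-equivalence) with $\vdash_{\mathcal F}t:D$. An $I$-type $D$ is infinite if $\Lambda(D)$ is infinite. *)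

theory Defs
  imports Main
begin

section \<open>Untyped terms, with de Bruijn indices (equality is alpha-equivalence)\<close>

datatype tm = Var nat | App tm tm | Lam tm

fun free :: "nat \<Rightarrow> tm \<Rightarrow> bool" where
  "free k (Var i) \<longleftrightarrow> i = k"
| "free k (App t u) \<longleftrightarrow> free k t \<or> free k u"
| "free k (Lam t) \<longleftrightarrow> free (Suc k) t"

definition closed :: "tm \<Rightarrow> bool" where
  "closed t \<longleftrightarrow> (\<forall>k. \<not> free k t)"

fun lift :: "nat \<Rightarrow> tm \<Rightarrow> tm" where
  "lift k (Var i) = (if i < k then Var i else Var (Suc i))"
| "lift k (App t u) = App (lift k t) (lift k u)"
| "lift k (Lam t) = Lam (lift (Suc k) t)"

text \<open>Substitution of \<open>s\<close> for index \<open>k\<close>; the binder of \<open>k\<close> disappears, so larger indices decrease.\<close>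

fun subst :: "nat \<Rightarrow> tm \<Rightarrow> tm \<Rightarrow> tm" where
  "subst k s (Var i) = (if i < k then Var i else if i = k then s else Var (i - 1))"
| "subst k s (App t u) = App (subst k s t) (subst k s u)"
| "subst k s (Lam t) = Lam (subst (Suc k) (lift 0 s) t)"

inductive beta :: "tm \<Rightarrow> tm \<Rightarrow> bool" where
  beta_redex: "beta (App (Lam t) u) (subst 0 u t)"
| beta_appL: "beta t t' \<Longrightarrow> beta (App t u) (App t' u)"
| beta_appR: "beta u u' \<Longrightarrow> beta (App t u) (App t u')"
| beta_lam: "beta t t' \<Longrightarrow> beta (Lam t) (Lam t')"

text \<open>The shape \<open>lift 0 t\<close> expresses that the abstracted variable is not free in the function part.\<close>

inductive eta :: "tm \<Rightarrow> tm \<Rightarrow> bool" where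
  eta_redex: "eta (Lam (App (lift 0 t) (Var 0))) t"
| eta_appL: "eta t t' \<Longrightarrow> eta (App t u) (App t' u)"
| eta_appR: "eta u u' \<Longrightarrow> eta (App t u) (App t u')"
| eta_lam: "eta t t' \<Longrightarrow> eta (Lam t) (Lam t')"

definition beta_eta :: "tm \<Rightarrow> tm \<Rightarrow> bool" where
  "beta_eta t t' \<longleftrightarrow> beta t t' \<or> eta t t'"

definition beta_normal :: "tm \<Rightarrow> bool" where
  "beta_normal t \<longleftrightarrow> (\<nexists>t'. beta t t')"

definition beta_eta_normal :: "tm \<Rightarrow> bool" where
  "beta_eta_normal t \<longleftrightarrow> (\<nexists>t'. beta_eta t t')"

definition beta_eta_nf :: "tm \<Rightarrow> tm" where
  "beta_eta_nf t = (THE s. rtranclp beta_eta t s \<and> beta_eta_normal s)"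

inductive lambda_I :: "tm \<Rightarrow> bool" where
  lambda_I_var: "lambda_I (Var i)"
| lambda_I_app: "lambda_I u \<Longrightarrow> lambda_I v \<Longrightarrow> lambda_I (App u v)"
| lambda_I_lam: "lambda_I u \<Longrightarrow> free 0 u \<Longrightarrow> lambda_I (Lam u)"


section \<open>System F types, with de Bruijn indices, and Curry-style typing\<close>

datatype ty = TVar nat | Fun ty ty | All ty

fun tfree :: "nat \<Rightarrow> ty \<Rightarrow> bool" where
  "tfree k (TVar i) \<longleftrightarrow> i = k"
| "tfree k (Fun A B) \<longleftrightarrow> tfree k A \<or> tfree k B"
| "tfree k (All A) \<longleftrightarrow> tfree (Suc k) A"

definition tclosed :: "ty \<Rightarrow> bool" where
  "tclosed A \<longleftrightarrow> (\<forall>k. \<not> tfree k A)"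

fun tlift :: "nat \<Rightarrow> ty \<Rightarrow> ty" where
  "tlift k (TVar i) = (if i < k then TVar i else TVar (Suc i))"
| "tlift k (Fun A B) = Fun (tlift k A) (tlift k B)"
| "tlift k (All A) = All (tlift (Suc k) A)"

fun tsubst :: "nat \<Rightarrow> ty \<Rightarrow> ty \<Rightarrow> ty" where
  "tsubst k G (TVar i) = (if i < k then TVar i else if i = k then G else TVar (i - 1))"
| "tsubst k G (Fun A B) = Fun (tsubst k G A) (tsubst k G B)"
| "tsubst k G (All A) = All (tsubst (Suc k) (tlift 0 G) A)"

fun proper :: "ty \<Rightarrow> bool" where
  "proper (TVar i) \<longleftrightarrow> True"
| "proper (Fun A B) \<longleftrightarrow> proper A \<and> proper B"
| "proper (All E) \<longleftrightarrow> tfree 0 E \<and> proper E"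

text \<open>
  Position \<open>i\<close> of the context is the type of the term variable \<open>i\<close>.  In rule \<open>all_intro\<close> the
  lifting of the context expresses that the generalised type variable is not free in it.
  All types occurring in a derivation are proper: the side conditions in \<open>ax\<close>, \<open>all_intro\<close> and
  \<open>all_elim\<close> suffice for this, see \<open>typing_proper\<close> below.
\<close>

inductive typing :: "ty list \<Rightarrow> tm \<Rightarrow> ty \<Rightarrow> bool"  ("_ \<turnstile> _ : _" [50, 50, 50] 50) where
  ax: "\<forall>A \<in> set \<Gamma>. proper A \<Longrightarrow> i < length \<Gamma> \<Longrightarrow> \<Gamma> \<turnstile> Var i : \<Gamma> ! i"
| fun_intro: "A # \<Gamma> \<turnstile> t : B \<Longrightarrow> \<Gamma> \<turnstile> Lam t : Fun A B"
| fun_elim: "\<Gamma> \<turnstile> u : Fun A B \<Longrightarrow> \<Gamma> \<turnstile> v : A \<Longrightarrow> \<Gamma> \<turnstile> App u v : B"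
| all_intro: "map (tlift 0) \<Gamma> \<turnstile> t : A \<Longrightarrow> proper (All A) \<Longrightarrow> \<Gamma> \<turnstile> t : All A"
| all_elim: "\<Gamma> \<turnstile> t : All A \<Longrightarrow> proper G \<Longrightarrow> \<Gamma> \<turnstile> t : tsubst 0 G A"

lemma tfree_tlift: "i < k \<Longrightarrow> tfree i (tlift k A) \<longleftrightarrow> tfree i A"
  by (induction A arbitrary: i k) auto

lemma proper_tlift: "proper (tlift k A) \<longleftrightarrow> proper A"
  by (induction A arbitrary: k) (auto simp: tfree_tlift)

lemma tfree_tsubst: "i < k \<Longrightarrow> tfree i A \<Longrightarrow> tfree i (tsubst k G A)"
  by (induction A arbitrary: i k G) auto

lemma proper_tsubst: "proper A \<Longrightarrow> proper G \<Longrightarrow> proper (tsubst k G A)"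
  by (induction A arbitrary: k G) (auto simp: tfree_tsubst proper_tlift)

lemma typing_proper: "\<Gamma> \<turnstile> t : A \<Longrightarrow> (\<forall>B \<in> set \<Gamma>. proper B) \<and> proper A"
  by (induction rule: typing.induct) (auto simp: proper_tlift proper_tsubst)


section \<open>I-types\<close>

definition I_type :: "ty \<Rightarrow> bool" where
  "I_type D \<longleftrightarrow> proper D \<and> tclosed D \<and>
     (\<forall>t. closed t \<and> beta_normal t \<and> [] \<turnstile> t : D \<longrightarrow> lambda_I t)"

definition Lambda :: "ty \<Rightarrow> tm set" where
  "Lambda D = {t. closed t \<and> beta_eta_normal t \<and> [] \<turnstile> t : D}"

definition infinite_I_type :: "ty \<Rightarrow> bool" where
  "infinite_I_type D \<longleftrightarrow> I_type D \<and> infinite (Lambda D)"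


section \<open>The type \<open>B_inf\<close> and the terms \<open>T i j\<close>\<close>

definition arrows :: "ty list \<Rightarrow> ty \<Rightarrow> ty" where
  "arrows As A = foldr Fun As A"

definition conj_ty :: "ty \<Rightarrow> ty \<Rightarrow> ty" where
  "conj_ty A B = All (Fun (Fun (tlift 0 A) (Fun (tlift 0 B) (TVar 0))) (TVar 0))"

definition pair :: "tm \<Rightarrow> tm \<Rightarrow> tm" where
  "pair u v = Lam (App (App (Var 0) (lift 0 u)) (lift 0 v))"

definition B_inf :: ty where
  "B_inf = (let X = TVar 1; Y = TVar 0 in
     All (All (arrows [Fun X Y, Fun Y X] (conj_ty (Fun X Y) (Fun Y X)))))"

text \<open>
  \<open>zigzag x y z n\<close> is the beta-eta-normal form of \<open>\<lambda>u (x)(y)...(x)(y)(z)u\<close>, with \<open>(x)(y)\<close> repeated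
  \<open>n\<close> times. The arguments \<open>x\<close>, \<open>y\<close>, \<open>z\<close> are the indices of the variables outside of
  the abstraction over \<open>u\<close>, hence the successors.
\<close>

definition zigzag_raw :: "nat \<Rightarrow> nat \<Rightarrow> nat \<Rightarrow> nat \<Rightarrow> tm" where
  "zigzag_raw x y z n =
     Lam (((\<lambda>w. App (Var (Suc x)) (App (Var (Suc y)) w)) ^^ n) (App (Var (Suc z)) (Var 0)))"

definition zigzag :: "nat \<Rightarrow> nat \<Rightarrow> nat \<Rightarrow> nat \<Rightarrow> tm" where
  "zigzag x y z n = beta_eta_nf (zigzag_raw x y z n)"

text \<open>The definite description in \<open>beta_eta_nf\<close> is well-defined on these terms.\<close>

lemma beta_Var: "\<not> beta (Var i) t"
  by (auto elim: beta.cases)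

lemma eta_Var: "\<not> eta (Var i) t"
  by (auto elim: eta.cases)

lemma beta_eta_nf_eqI:
  assumes "\<And>t'. beta_eta t t' \<Longrightarrow> t' = s" and "t = s \<or> beta_eta t s" and "beta_eta_normal s"
  shows "beta_eta_nf t = s"
  unfolding beta_eta_nf_def
proof (rule the_equality)
  show "rtranclp beta_eta t s \<and> beta_eta_normal s"
    using assms(2,3) by auto
  fix r assume r: "rtranclp beta_eta t r \<and> beta_eta_normal r"
  have sr: "r' = s" if "rtranclp beta_eta s r'" for r'
    using that assms(3) by (auto simp: beta_eta_normal_def elim: converse_rtranclpE)
  from r have "rtranclp beta_eta t r" by simp
  then show "r = s"
  proof (cases rule: converse_rtranclpE)
    case base
    then show ?thesis using assms(2) r by (auto simp: beta_eta_normal_def)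
  next
    case (step y)
    then show ?thesis using assms(1) sr by blast
  qed
qed

lemma zigzag_0: "zigzag x y z 0 = Var z"
  unfolding zigzag_def
proof (rule beta_eta_nf_eqI)
  have shape: "t = Var z" if "lift 0 t = Var (Suc z)" for t
    using that by (cases t) auto
  show "t' = Var z" if "beta_eta (zigzag_raw x y z 0) t'" for t'
    using that unfolding beta_eta_def zigzag_raw_def
    by (auto elim!: beta.cases[of "Lam _"] beta.cases[of "App _ _"] eta.cases[of "Lam _"]
          eta.cases[of "App _ _"] simp: beta_Var eta_Var shape)
  show "zigzag_raw x y z 0 = Var z \<or> beta_eta (zigzag_raw x y z 0) (Var z)"
    using eta_redex[of "Var z"] by (simp add: zigzag_raw_def beta_eta_def)
  show "beta_eta_normal (Var z)"
    by (simp add: beta_eta_normal_def beta_eta_def beta_Var eta_Var)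
qed

lemma zigzag_Suc: "zigzag x y z (Suc n) = zigzag_raw x y z (Suc n)"
  unfolding zigzag_def
proof (rule beta_eta_nf_eqI)
  let ?f = "\<lambda>w. App (Var (Suc x)) (App (Var (Suc y)) w)"
  have app: "\<not> beta_eta (App (Var k) w) t" if "\<And>s. \<not> beta_eta w s" for k w t
    using that unfolding beta_eta_def
    by (auto elim!: beta.cases[of "App _ _"] eta.cases[of "App _ _"] simp: beta_Var eta_Var)
  have "\<not> beta_eta ((?f ^^ m) (App (Var (Suc z)) (Var 0))) t" for m t
  proof (induction m arbitrary: t)
    case 0
    show ?case by (simp, rule app) (simp add: beta_eta_def beta_Var eta_Var)
  next
    case (Suc m)
    show ?case by (simp, intro app) (rule Suc.IH)
  qed
  from this[of "Suc n"] show norm: "beta_eta_normal (zigzag_raw x y z (Suc n))"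
    unfolding beta_eta_normal_def zigzag_raw_def beta_eta_def
    by (auto elim!: beta.cases[of "Lam _"] eta.cases[of "Lam _"])
  show "t' = zigzag_raw x y z (Suc n)" if "beta_eta (zigzag_raw x y z (Suc n)) t'" for t'
    using norm that by (auto simp: beta_eta_normal_def)
qed simp

definition T :: "nat \<Rightarrow> nat \<Rightarrow> tm" where
  "T i j = (let x = 1; y = 0 in Lam (Lam (pair (zigzag x y x i) (zigzag y x y j))))"

end

theory Submission imports Defs begin

text \<open>
  Idea: a beta-normal inhabitant of \<open>B_inf\<close> only ever has variables of quantifier-free type in its
  context. There a term with a head variable \<open>x\<close> can only get a type that ends the type of \<open>x\<close>:
  generalising it would quantify over a variable that does not occur, which properness forbids,
  so no quantifier ever appears on the path to the head. For abstractions the quantifier detours are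
  removed by type substitution. The shape of the inhabitants is then read off from the outside in.
\<close>

section \<open>Parallel type substitution\<close>

definition up :: "(nat \<Rightarrow> ty) \<Rightarrow> nat \<Rightarrow> ty" where
  "up \<sigma> = case_nat (TVar 0) (\<lambda>i. tlift 0 (\<sigma> i))"

lemma up_simps [simp]: "up \<sigma> 0 = TVar 0" "up \<sigma> (Suc i) = tlift 0 (\<sigma> i)"
  by (simp_all add: up_def)

text \<open>Acting on all type variables at once makes composition pointwise. Both
  \<open>tlift\<close> and \<open>tsubst\<close> are special cases.\<close>

fun psubst :: "(nat \<Rightarrow> ty) \<Rightarrow> ty \<Rightarrow> ty" where
  "psubst \<sigma> (TVar i) = \<sigma> i"
| "psubst \<sigma> (Fun A B) = Fun (psubst \<sigma> A) (psubst \<sigma> B)"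
| "psubst \<sigma> (All A) = All (psubst (up \<sigma>) A)"

lemma psubst_TVar: "psubst TVar A = A"
proof (induction A)
  case (All A)
  have "up TVar = TVar"
    by (rule ext) (simp add: up_def split: nat.split)
  with All show ?case by simp
qed auto

lemma tlift_tlift: "j \<le> k \<Longrightarrow> tlift (Suc k) (tlift j A) = tlift j (tlift k A)"
  by (induction A arbitrary: j k) auto

lemma psubst_tlift: "psubst \<sigma> (tlift k A) = psubst (\<lambda>i. \<sigma> (if i < k then i else Suc i)) A"
proof (induction A arbitrary: \<sigma> k)
  case (All A)
  have "(\<lambda>i. up \<sigma> (if i < Suc k then i else Suc i)) = up (\<lambda>i. \<sigma> (if i < k then i else Suc i))"
    by (rule ext) (auto simp: up_def split: nat.split)
  with All show ?case by simp
qed auto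

lemma tlift_psubst: "tlift k (psubst \<sigma> A) = psubst (\<lambda>i. tlift k (\<sigma> i)) A"
proof (induction A arbitrary: \<sigma> k)
  case (All A)
  have "(\<lambda>i. tlift (Suc k) (up \<sigma> i)) = up (\<lambda>i. tlift k (\<sigma> i))"
    by (rule ext) (auto simp: up_def tlift_tlift split: nat.split)
  with All show ?case by simp
qed auto

lemma psubst_up_tlift: "psubst (up \<sigma>) (tlift 0 A) = tlift 0 (psubst \<sigma> A)"
  by (simp add: psubst_tlift tlift_psubst)

lemma psubst_psubst: "psubst \<sigma> (psubst \<tau> A) = psubst (\<lambda>i. psubst \<sigma> (\<tau> i)) A"
proof (induction A arbitrary: \<sigma> \<tau>)
  case (All A)
  have "(\<lambda>i. psubst (up \<sigma>) (up \<tau> i)) = up (\<lambda>i. psubst \<sigma> (\<tau> i))"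
    by (rule ext) (auto simp: up_def psubst_up_tlift[unfolded up_def] split: nat.split)
  with All show ?case by simp
qed auto

lemma tlift_conv_psubst: "tlift k A = psubst (\<lambda>i. TVar (if i < k then i else Suc i)) A"
  using psubst_tlift[of TVar k A] by (simp add: psubst_TVar)

lemma tsubst_conv_psubst:
  "tsubst k G A = psubst (\<lambda>i. if i < k then TVar i else if i = k then G else TVar (i - 1)) A"
proof (induction A arbitrary: k G)
  case (All A)
  have "(\<lambda>i. if i < Suc k then TVar i else if i = Suc k then tlift 0 G else TVar (i - 1)) =
      up (\<lambda>i. if i < k then TVar i else if i = k then G else TVar (i - 1))"
    by (rule ext) (auto simp: up_def split: nat.split)
  with All show ?case by simp
qed auto

text \<open>Absorbs an instantiation into the current substitution as its value at 0. This is how an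
  introduction followed by an elimination cancels.\<close>

lemma tsubst_psubst_up: "tsubst 0 G (psubst (up \<sigma>) A) = psubst (case_nat G \<sigma>) A"
proof -
  have "(\<lambda>i. psubst (\<lambda>i. if i < 0 then TVar i else if i = 0 then G else TVar (i - 1)) (up \<sigma> i))
      = case_nat G \<sigma>"
    by (rule ext) (auto simp: up_def psubst_tlift psubst_TVar split: nat.split)
  then show ?thesis by (simp add: tsubst_conv_psubst psubst_psubst)
qed

lemma psubst_tsubst: "psubst \<sigma> (tsubst 0 G A) = tsubst 0 (psubst \<sigma> G) (psubst (up \<sigma>) A)"
proof -
  have "(\<lambda>i. psubst \<sigma> (if i < 0 then TVar i else if i = 0 then G else TVar (i - 1))) =
      case_nat (psubst \<sigma> G) \<sigma>"
    by (rule ext) (auto split: nat.split)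
  then show ?thesis by (simp add: tsubst_psubst_up tsubst_conv_psubst[of 0 G] psubst_psubst)
qed

lemma psubst_case_nat_tlift: "psubst (case_nat G \<sigma>) (tlift 0 A) = psubst \<sigma> A"
  by (simp add: psubst_tlift)

lemma tfree_psubst: "tfree i A \<Longrightarrow> tfree k (\<sigma> i) \<Longrightarrow> tfree k (psubst \<sigma> A)"
proof (induction A arbitrary: i k \<sigma>)
  case (All A)
  have "tfree (Suc k) (tlift 0 B)" if "tfree k B" for k B
  proof -
    \<comment> \<open>The cutoff is generalised because passing a quantifier raises \<open>j\<close>
      together with \<open>k\<close>.\<close>
    have "tfree (Suc k) (tlift j B)" if "tfree k B" "j \<le> k" for j
      using that by (induction B arbitrary: j k) auto
    with that show ?thesis by simp
  qed
  with All show ?case by simp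
qed auto

text \<open>A bound variable is fixed by \<open>up\<close>, so it stays free in the body of its
  quantifier.\<close>

lemma proper_psubst: "proper A \<Longrightarrow> (\<And>i. proper (\<sigma> i)) \<Longrightarrow> proper (psubst \<sigma> A)"
proof (induction A arbitrary: \<sigma>)
  case (All A)
  have "proper (up \<sigma> i)" for i
    using All.prems(2) by (cases i) (auto simp: proper_tlift)
  with All show ?case by (auto intro: tfree_psubst[where i = 0])
qed auto

lemma typing_psubst:
  "\<Gamma> \<turnstile> t : A \<Longrightarrow> (\<And>i. proper (\<sigma> i)) \<Longrightarrow> map (psubst \<sigma>) \<Gamma> \<turnstile> t : psubst \<sigma> A"
proof (induction arbitrary: \<sigma> rule: typing.induct)
  case (ax \<Gamma> i)
  then have "map (psubst \<sigma>) \<Gamma> \<turnstile> Var i : map (psubst \<sigma>) \<Gamma> ! i"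
    by (intro typing.ax) (auto intro: proper_psubst)
  with ax show ?case by simp
next
  case (fun_intro A \<Gamma> t B)
  then show ?case by (auto intro: typing.fun_intro)
next
  case (fun_elim \<Gamma> u A B v)
  then show ?case by (auto intro: typing.fun_elim)
next
  case (all_intro \<Gamma> t A)
  have pr: "proper (up \<sigma> i)" for i
    using all_intro.prems by (cases i) (auto simp: proper_tlift)
  have "map (psubst (up \<sigma>)) (map (tlift 0) \<Gamma>) \<turnstile> t : psubst (up \<sigma>) A"
    by (rule all_intro.IH) (rule pr)
  moreover have "proper (psubst \<sigma> (All A))"
    by (rule proper_psubst) (use all_intro in auto)
  ultimately show ?case
    by (auto intro!: typing.all_intro simp: psubst_up_tlift comp_def)
next
  case (all_elim \<Gamma> t A G)
  then show ?case
    unfolding psubst_tsubst by (intro typing.all_elim) (auto intro: proper_psubst)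
qed

section \<open>Generation lemmas\<close>

text \<open>Inverts \<open>all_intro\<close> without inspecting the derivation: shift all type
  variables by one, then instantiate the quantifier with the fresh variable 0. Together the two act
  on \<open>A\<close> as the identity.\<close>

lemma typing_All:
  assumes "\<Gamma> \<turnstile> t : All A"
  shows "map (tlift 0) \<Gamma> \<turnstile> t : A"
proof -
  let ?\<sigma> = "\<lambda>i. TVar (Suc i)"
  have lift: "psubst ?\<sigma> = tlift 0"
    by (rule ext) (simp add: tlift_conv_psubst)
  have "map (psubst ?\<sigma>) \<Gamma> \<turnstile> t : All (psubst (up ?\<sigma>) A)"
    using typing_psubst[OF assms, of ?\<sigma>] by simp
  then have "map (tlift 0) \<Gamma> \<turnstile> t : All (psubst (up ?\<sigma>) A)" unfolding lift .
  from typing.all_elim[OF this, of "TVar 0"]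
  have "map (tlift 0) \<Gamma> \<turnstile> t : psubst (case_nat (TVar 0) ?\<sigma>) A" by (simp add: tsubst_psubst_up)
  moreover have "case_nat (TVar 0) ?\<sigma> = TVar"
    by (rule ext) (simp split: nat.split)
  ultimately show ?thesis by (simp add: psubst_TVar)
qed

text \<open>Describes what repeated use of \<open>all_elim\<close> can extract from a type.\<close>

inductive inst :: "ty \<Rightarrow> ty \<Rightarrow> bool" where
  inst_refl: "inst A A"
| inst_All: "proper G \<Longrightarrow> inst (tsubst 0 G A) B \<Longrightarrow> inst (All A) B"

text \<open>Read from the last rule upwards, \<open>inst\<close> holds the eliminations still
  pending, and \<open>\<sigma>\<close> those already cancelled against an introduction. As
  \<open>D\<close> is not a quantifier, every \<open>all_intro\<close> meets a pending elimination;
  an arrow type leaves none.\<close>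

lemma typing_Lam_inst:
  assumes "\<Gamma> \<turnstile> Lam t : A" "\<And>i. proper (\<sigma> i)" "inst (psubst \<sigma> A) D" "\<nexists>E. D = All E"
  shows "\<exists>B C. D = Fun B C \<and> (B # map (psubst \<sigma>) \<Gamma> \<turnstile> t : C)"
  using assms
proof (induction \<Gamma> "Lam t" A arbitrary: \<sigma> rule: typing.induct)
  case (fun_intro A \<Gamma> B)
  from fun_intro.prems(2) have "D = Fun (psubst \<sigma> A) (psubst \<sigma> B)"
    by (auto elim: inst.cases)
  with typing_psubst[OF fun_intro.hyps(1), of \<sigma>] fun_intro.prems(1) show ?case by auto
next
  case (all_intro \<Gamma> A)
  from all_intro.prems(2,3) obtain G where G: "proper G" "inst (psubst (case_nat G \<sigma>) A) D"
    by (auto elim: inst.cases simp: tsubst_psubst_up)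
  have "proper (case_nat G \<sigma> i)" for i
    using G all_intro.prems(1) by (simp split: nat.split)
  from all_intro.hyps(2)[OF this G(2) all_intro.prems(3)] show ?case
    by (simp add: comp_def psubst_case_nat_tlift)
next
  case (all_elim \<Gamma> A G)
  \<comment> \<open>The elimination becomes one more pending step, with type argument
    \<open>psubst \<sigma> G\<close>.\<close>
  from all_elim.prems(2) have "inst (psubst \<sigma> (All A)) D"
    using all_elim.hyps(3) all_elim.prems(1)
    by (auto simp: psubst_tsubst intro!: inst_All[of "psubst \<sigma> G"] proper_psubst)
  then show ?case using all_elim by blast
qed

lemma typing_Lam:
  assumes "\<Gamma> \<turnstile> Lam t : D" "\<nexists>E. D = All E"
  shows "\<exists>B C. D = Fun B C \<and> (B # \<Gamma> \<turnstile> t : C)"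
proof -
  have "psubst TVar = id" by (rule ext) (simp add: psubst_TVar)
  with typing_Lam_inst[OF assms(1), of TVar D] assms(2) show ?thesis
    by (auto intro: inst_refl)
qed

lemma typing_Lam_Fun: "\<Gamma> \<turnstile> Lam t : Fun B C \<Longrightarrow> B # \<Gamma> \<turnstile> t : C"
  using typing_Lam by blast

lemma typing_Lam_TVar: "\<not> (\<Gamma> \<turnstile> Lam t : TVar i)"
  using typing_Lam by blast

section \<open>Spines of beta-normal terms\<close>

fun neutral :: "tm \<Rightarrow> bool" where
  "neutral (Var i) \<longleftrightarrow> True"
| "neutral (App t u) \<longleftrightarrow> neutral t"
| "neutral (Lam t) \<longleftrightarrow> False"

lemma beta_normal_Lam: "beta_normal (Lam t) \<Longrightarrow> beta_normal t"
  by (auto simp: beta_normal_def intro: beta_lam)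

lemma beta_normal_App:
  "beta_normal (App t u) \<Longrightarrow> beta_normal t \<and> beta_normal u \<and> (\<forall>s. t \<noteq> Lam s)"
  by (auto simp: beta_normal_def intro: beta.intros)

lemma beta_normal_cases:
  assumes "beta_normal t"
  obtains s where "t = Lam s" "beta_normal s" | "neutral t"
proof -
  have "(\<exists>s. t = Lam s) \<or> neutral t"
    using assms by (induction t) (auto dest: beta_normal_App)
  then show ?thesis using that assms beta_normal_Lam by blast
qed

lemma beta_normal_foldl_App: "beta_normal (foldl App t us) \<Longrightarrow> u \<in> set us \<Longrightarrow> beta_normal u"
proof (induction us rule: rev_induct)
  case (snoc v us)
  then show ?case by (auto dest: beta_normal_App)
qed simp

fun quantifier_free :: "ty \<Rightarrow> bool" where
  "quantifier_free (TVar i) \<longleftrightarrow> True"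
| "quantifier_free (Fun A B) \<longleftrightarrow> quantifier_free A \<and> quantifier_free B"
| "quantifier_free (All A) \<longleftrightarrow> False"

lemma quantifier_free_tlift: "quantifier_free (tlift k A) = quantifier_free A"
  by (induction A arbitrary: k) auto

lemma quantifier_free_foldr: "quantifier_free (foldr Fun As A) \<Longrightarrow> quantifier_free A"
  by (induction As) auto

lemma not_tfree_tlift: "\<not> tfree k (tlift k A)"
  by (induction A arbitrary: k) auto

lemma tfree_foldr: "tfree k A \<Longrightarrow> tfree k (foldr Fun As A)"
  by (induction As) auto

text \<open>\<open>us\<close> are the arguments of the head variable and \<open>As\<close> their
  types. Each \<open>fun_elim\<close> on the path to the head adds one argument.\<close>

lemma neutral_spine:
  assumes "\<Gamma> \<turnstile> t : A" "neutral t" "\<forall>B\<in>set \<Gamma>. quantifier_free B"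
  shows "\<exists>i us As. i < length \<Gamma> \<and> t = foldl App (Var i) us \<and> \<Gamma> ! i = foldr Fun As A
    \<and> list_all2 (\<lambda>u B. \<Gamma> \<turnstile> u : B) us As"
  using assms
proof (induction rule: typing.induct)
  case (ax \<Gamma> i)
  then show ?case by (intro exI[of _ i] exI[of _ "[]"]) auto
next
  case (fun_intro A \<Gamma> t B)
  then show ?case by simp
next
  case (fun_elim \<Gamma> u A B v)
  then obtain i us As where *: "i < length \<Gamma>" "u = foldl App (Var i) us"
    "\<Gamma> ! i = foldr Fun As (Fun A B)" "list_all2 (\<lambda>u B. \<Gamma> \<turnstile> u : B) us As" by auto
  then have "list_all2 (\<lambda>u B. \<Gamma> \<turnstile> u : B) (us @ [v]) (As @ [A])"
    using fun_elim.hyps(2) by (intro list_all2_appendI) auto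
  with * show ?case by (intro exI[of _ i] exI[of _ "us @ [v]"] exI[of _ "As @ [A]"]) auto
next
  case (all_intro \<Gamma> t A)
  then obtain i As where "i < length \<Gamma>" "tlift 0 (\<Gamma> ! i) = foldr Fun As A"
    by (auto simp: quantifier_free_tlift)
  \<comment> \<open>\<open>A\<close> ends a lifted type, which cannot contain the index 0 that
    properness of \<open>All A\<close> demands.\<close>
  then have "\<not> tfree 0 A" using not_tfree_tlift[of 0 "\<Gamma> ! i"] tfree_foldr by metis
  with all_intro show ?case by simp
next
  case (all_elim \<Gamma> t A G)
  then obtain i As where "i < length \<Gamma>" "\<Gamma> ! i = foldr Fun As (All A)" by blast
  with all_elim.prems(2) have "quantifier_free (All A)"
    by (metis nth_mem quantifier_free_foldr)
  then show ?case by simp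
qed

section \<open>Alternating chains\<close>

abbreviation chain :: "nat \<Rightarrow> nat \<Rightarrow> nat \<Rightarrow> tm \<Rightarrow> tm" where
  "chain p q n \<equiv> (\<lambda>w. App (Var p) (App (Var q) w)) ^^ n"

text \<open>Regroups an alternating word by one letter, so that peeling off a head exchanges the
  roles of \<open>p\<close> and \<open>q\<close>.\<close>

lemma chain_App: "chain p q n (App (Var p) w) = App (Var p) (chain q p n w)"
  by (induction n) auto

text \<open>Only \<open>p\<close> yields \<open>Q\<close>, from one \<open>P\<close>; only
  \<open>z\<close> itself, or \<open>q\<close> applied to a \<open>Q\<close>, yields
  \<open>P\<close>. The two claims feed each other, hence the simultaneous induction. As
  \<open>P\<close> and \<open>Q\<close> are atoms, no abstraction has either type.\<close>

lemma typed_chain: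
  assumes qf: "\<forall>B\<in>set \<Gamma>. quantifier_free B"
    and p: "\<And>i As. i < length \<Gamma> \<Longrightarrow> \<Gamma> ! i = foldr Fun As Q \<Longrightarrow> i = p \<and> As = [P]"
    and q: "\<And>i As. i < length \<Gamma> \<Longrightarrow> \<Gamma> ! i = foldr Fun As P \<Longrightarrow> i = z \<and> As = [] \<or> i = q \<and> As = [Q]"
    and PQ: "P = TVar a" "Q = TVar b"
    and "beta_normal t"
  shows "(\<Gamma> \<turnstile> t : Q \<longrightarrow> (\<exists>n. t = chain p q n (App (Var p) (Var z))))
    \<and> (\<Gamma> \<turnstile> t : P \<longrightarrow> (\<exists>n. t = chain q p n (Var z)))"
  using \<open>beta_normal t\<close>
proof (induction t)
  case (Var j)
  \<comment> \<open>A head yielding \<open>Q\<close> takes exactly one argument, whereas a bare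
    variable has none.\<close>
  have "False" if Q: "\<Gamma> \<turnstile> Var j : Q"
  proof -
    from neutral_spine[OF Q _ qf] obtain i us As where *: "i < length \<Gamma>"
      "Var j = foldl App (Var i) us" "\<Gamma> ! i = foldr Fun As Q"
      "list_all2 (\<lambda>u B. \<Gamma> \<turnstile> u : B) us As" by auto
    with p[OF *(1,3)] show ?thesis by (auto simp: list_all2_Cons2)
  qed
  moreover have "j = z" if P: "\<Gamma> \<turnstile> Var j : P"
  proof -
    from neutral_spine[OF P _ qf] obtain i us As where *: "i < length \<Gamma>"
      "Var j = foldl App (Var i) us" "\<Gamma> ! i = foldr Fun As P"
      "list_all2 (\<lambda>u B. \<Gamma> \<turnstile> u : B) us As" by auto
    with q[OF *(1,3)] show ?thesis by (auto simp: list_all2_Cons2)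
  qed
  ultimately show ?case by (auto intro: exI[of _ 0])
next
  case (App s u)
  have neu: "neutral (App s u)" and nu: "beta_normal u"
    using App.prems by (auto elim: beta_normal_cases dest: beta_normal_App)
  have "\<exists>n. App s u = chain p q n (App (Var p) (Var z))" if ty: "\<Gamma> \<turnstile> App s u : Q"
  proof -
    from neutral_spine[OF ty neu qf] obtain i us As where *: "i < length \<Gamma>"
      "App s u = foldl App (Var i) us" "\<Gamma> ! i = foldr Fun As Q"
      "list_all2 (\<lambda>u B. \<Gamma> \<turnstile> u : B) us As" by auto
    with p[OF *(1,3)] have "s = Var p" "\<Gamma> \<turnstile> u : P" by (auto simp: list_all2_Cons2)
    with App.IH(2)[OF nu] chain_App show ?thesis by metis
  qed
  moreover have "\<exists>n. App s u = chain q p n (Var z)" if ty: "\<Gamma> \<turnstile> App s u : P"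
  proof -
    from neutral_spine[OF ty neu qf] obtain i us As where *: "i < length \<Gamma>"
      "App s u = foldl App (Var i) us" "\<Gamma> ! i = foldr Fun As P"
      "list_all2 (\<lambda>u B. \<Gamma> \<turnstile> u : B) us As" by auto
    with q[OF *(1,3)] have "s = Var q" "\<Gamma> \<turnstile> u : Q" by (auto simp: list_all2_Cons2)
    with App.IH(2)[OF nu] obtain n where "App s u = App (Var q) (chain p q n (App (Var p) (Var z)))"
      by auto
    \<comment> \<open>The leading \<open>q\<close> and the last \<open>p\<close> complete one more
      turn, hence \<open>Suc n\<close>.\<close>
    then have "App s u = chain q p (Suc n) (Var z)" by (simp add: chain_App)
    then show ?thesis by blast
  qed
  ultimately show ?case by blast
next
  case (Lam t)
  then show ?case using PQ typing_Lam_TVar by blast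
qed

lemma lambda_I_chain: "lambda_I w \<Longrightarrow> lambda_I (chain p q n w)"
  by (induction n) (auto intro: lambda_I.intros)

lemma free_chain: "free k (chain p q n w) \<longleftrightarrow> free k w \<or> n > 0 \<and> (k = p \<or> k = q)"
  by (induction n) auto

lemma lift_chain:
  "k \<le> p \<Longrightarrow> k \<le> q \<Longrightarrow> lift k (chain p q n w) = chain (Suc p) (Suc q) n (lift k w)"
  by (induction n) auto

lemma typing_chain:
  assumes "\<Gamma> \<turnstile> Var p : Fun B A" "\<Gamma> \<turnstile> Var q : Fun A B" "\<Gamma> \<turnstile> w : A"
  shows "\<Gamma> \<turnstile> chain p q n w : A"
  by (induction n) (auto intro: assms fun_elim)

text \<open>Each turn adds 2 to the size of the term.\<close>

lemma chain_inj: "chain p q m w = chain p q n w \<Longrightarrow> m = n"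
proof -
  have "size (chain p q n w) = 2 * n + size w" for n by (induction n) auto
  then show "chain p q m w = chain p q n w \<Longrightarrow> m = n"
    by (metis add_right_cancel mult_left_cancel zero_neq_numeral)
qed

lemma zigzag_raw_conv_chain:
  "zigzag_raw x y z n = Lam (chain (Suc x) (Suc y) n (App (Var (Suc z)) (Var 0)))"
  by (simp add: zigzag_raw_def)

lemma zigzag_cases: "zigzag x y z n = (if n = 0 then Var z else zigzag_raw x y z n)"
  by (cases n) (simp_all only: zigzag_0 zigzag_Suc, simp_all)

lemma lift_zigzag: "lift 0 (zigzag x y z n) = zigzag (Suc x) (Suc y) (Suc z) n"
  by (simp add: zigzag_cases zigzag_raw_conv_chain lift_chain)

text \<open>The binder of the pair takes index 0, which moves \<open>x\<close> and \<open>y\<close>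
  to 2 and 1.\<close>

lemma T_eq: "T i j = Lam (Lam (Lam (App (App (Var 0) (zigzag 2 1 2 i)) (zigzag 1 2 1 j))))"
  by (simp add: T_def pair_def lift_zigzag numeral_2_eq_2)

lemma zigzag_inj: "zigzag x y x m = zigzag x y x n \<Longrightarrow> m = n"
  by (auto simp: zigzag_cases zigzag_raw_conv_chain dest: chain_inj split: if_splits)

section \<open>The inhabitants of \<open>B_inf\<close>\<close>

abbreviation \<comment> \<open>the context below all binders of an inhabitant, with \<open>X, Y, Z = 2, 1, 0\<close>\<close>
  B_ctx :: "ty list" where
  "B_ctx \<equiv> [Fun (Fun (TVar 2) (TVar 1)) (Fun (Fun (TVar 1) (TVar 2)) (TVar 0)),
    Fun (TVar 1) (TVar 2), Fun (TVar 2) (TVar 1)]"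

lemma B_inf_eq: "B_inf = All (All (Fun (Fun (TVar 1) (TVar 0)) (Fun (Fun (TVar 0) (TVar 1))
    (All (Fun (hd B_ctx) (TVar 0))))))"
  by (simp add: B_inf_def arrows_def conj_ty_def Let_def numeral_2_eq_2)

text \<open>With the next rule, the simplifier finds every way in which a concrete context entry can
  end in a given type, and thus all possible heads in \<open>neutral_spine\<close>.\<close>

lemma foldr_Fun_eq_TVar [simp]:
  "TVar i = foldr Fun As A \<longleftrightarrow> As = [] \<and> A = TVar i"
  by (cases As) auto

lemma foldr_Fun_eq_Fun [simp]:
  "Fun B C = foldr Fun As A \<longleftrightarrow> As = [] \<and> A = Fun B C \<or> (\<exists>As'. As = B # As' \<and> C = foldr Fun As' A)"
  by (cases As) auto

text \<open>A neutral term of this type can only be \<open>x\<close> itself; an abstraction has a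
  chain as body. Under beta-normality alone, the eta-expansion \<open>zigzag_raw 2 1 2 0\<close>
  appears beside \<open>Var 2\<close>.\<close>

lemma B_ctx_first:
  assumes "B_ctx \<turnstile> u : Fun (TVar 2) (TVar 1)" "beta_normal u"
  shows "u = Var 2 \<or> (\<exists>n. u = zigzag_raw 2 1 2 n)"
  using assms(2)
proof (cases rule: beta_normal_cases)
  case (1 s)
  have "TVar 2 # B_ctx \<turnstile> s : TVar 1" using assms(1) 1 typing_Lam_Fun by blast
  moreover have "(TVar 2 # B_ctx \<turnstile> s : TVar 1 \<longrightarrow> (\<exists>n. s = chain 3 2 n (App (Var 3) (Var 0))))
    \<and> (TVar 2 # B_ctx \<turnstile> s : TVar 2 \<longrightarrow> (\<exists>n. s = chain 2 3 n (Var 0)))"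
    \<comment> \<open>Below the binder of \<open>u\<close>, with index 0, \<open>x\<close> is 3 and
      \<open>y\<close> is 2; the variable 1 of the pair ends in \<open>TVar 0\<close> and cannot be
      a head.\<close>
    by (rule typed_chain[OF _ _ _ refl refl 1(2)])
      (auto simp: less_Suc_eq numeral_2_eq_2 numeral_3_eq_3)
  ultimately show ?thesis using 1(1) by (auto simp: zigzag_raw_conv_chain numeral_2_eq_2 numeral_3_eq_3)
next
  case 2
  from neutral_spine[OF assms(1) 2] show ?thesis
    by (auto simp: less_Suc_eq numeral_2_eq_2)
qed

text \<open>The mirror image, with \<open>x\<close> and \<open>y\<close> exchanged.\<close>

lemma B_ctx_second:
  assumes "B_ctx \<turnstile> u : Fun (TVar 1) (TVar 2)" "beta_normal u"
  shows "u = Var 1 \<or> (\<exists>n. u = zigzag_raw 1 2 1 n)"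
  using assms(2)
proof (cases rule: beta_normal_cases)
  case (1 s)
  have "TVar 1 # B_ctx \<turnstile> s : TVar 2" using assms(1) 1 typing_Lam_Fun by blast
  moreover have "(TVar 1 # B_ctx \<turnstile> s : TVar 2 \<longrightarrow> (\<exists>n. s = chain 2 3 n (App (Var 2) (Var 0))))
    \<and> (TVar 1 # B_ctx \<turnstile> s : TVar 1 \<longrightarrow> (\<exists>n. s = chain 3 2 n (Var 0)))"
    by (rule typed_chain[OF _ _ _ refl refl 1(2)])
      (auto simp: less_Suc_eq numeral_2_eq_2 numeral_3_eq_3)
  ultimately show ?thesis using 1(1) by (auto simp: zigzag_raw_conv_chain numeral_2_eq_2 numeral_3_eq_3)
next
  case 2
  from neutral_spine[OF assms(1) 2] show ?thesis
    by (auto simp: less_Suc_eq numeral_2_eq_2)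
qed

text \<open>Three times no context entry ends in the required type, which forces an abstraction. The
  remaining body has an atomic type and must be neutral.\<close>

lemma B_inf_inhabitant:
  assumes "[] \<turnstile> t : B_inf" "beta_normal t"
  obtains u v where "t = Lam (Lam (Lam (App (App (Var 0) u) v)))"
    "u = Var 2 \<or> (\<exists>n. u = zigzag_raw 2 1 2 n)" "v = Var 1 \<or> (\<exists>n. v = zigzag_raw 1 2 1 n)"
proof -
  let ?X = "TVar 1" and ?Y = "TVar 0"
  let ?C = "All (Fun (hd B_ctx) (TVar 0))"
  have ty: "[] \<turnstile> t : Fun (Fun ?X ?Y) (Fun (Fun ?Y ?X) ?C)"
    using typing_All[OF typing_All[OF assms(1)[unfolded B_inf_eq]]] by simp
  have "\<not> neutral t" using neutral_spine[OF ty] by auto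
  with assms(2) obtain t1 where t1: "t = Lam t1" "beta_normal t1"
    by (auto elim: beta_normal_cases)
  have ty1: "[Fun ?X ?Y] \<turnstile> t1 : Fun (Fun ?Y ?X) ?C" using ty t1 typing_Lam_Fun by blast
  have "\<not> neutral t1" using neutral_spine[OF ty1] by auto
  with t1 obtain t2 where t2: "t1 = Lam t2" "beta_normal t2" by (auto elim: beta_normal_cases)
  have ty2: "[Fun ?Y ?X, Fun ?X ?Y] \<turnstile> t2 : ?C" using ty1 t2 typing_Lam_Fun by blast
  have "\<not> neutral t2" using neutral_spine[OF ty2] by (auto simp: less_Suc_eq)
  with t2 obtain t3 where t3: "t2 = Lam t3" "beta_normal t3" by (auto elim: beta_normal_cases)
  \<comment> \<open>Opening the quantifier of the conjunction lifts the context, which turns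
    \<open>X\<close>, \<open>Y\<close> into 2, 1 as in \<open>B_ctx\<close>.\<close>
  have ty3: "B_ctx \<turnstile> t3 : TVar 0"
    using typing_Lam_Fun[OF typing_All[OF ty2[unfolded t3]]] by (simp add: numeral_2_eq_2)
  have "neutral t3" using ty3 t3 typing_Lam_TVar by (auto elim: beta_normal_cases)
  \<comment> \<open>Only variable 0 ends in the type \<open>TVar 0\<close>, and it takes both
    components as arguments.\<close>
  from neutral_spine[OF ty3 this] obtain u v where
    uv: "t3 = foldl App (Var 0) [u, v]"
    "B_ctx \<turnstile> u : Fun (TVar 2) (TVar 1)" "B_ctx \<turnstile> v : Fun (TVar 1) (TVar 2)"
    by (auto simp: less_Suc_eq list_all2_Cons2)
  then have "beta_normal u" "beta_normal v"
    using t3(2) beta_normal_foldl_App[of "Var 0" "[u, v]"] by auto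
  with uv B_ctx_first B_ctx_second that t1 t2 t3 show ?thesis by auto
qed

text \<open>Every binder is used: the pair variable as head, \<open>x\<close> in the first component
  and \<open>y\<close> in the second, whatever their lengths.\<close>

lemma I_type_B_inf: "I_type B_inf"
  unfolding I_type_def
proof (intro conjI allI impI)
  show "proper B_inf" "tclosed B_inf" by (auto simp: B_inf_eq tclosed_def)
  fix t assume "closed t \<and> beta_normal t \<and> [] \<turnstile> t : B_inf"
  then have "[] \<turnstile> t : B_inf" "beta_normal t" by auto
  then obtain u v where t: "t = Lam (Lam (Lam (App (App (Var 0) u) v)))"
    and u: "u = Var 2 \<or> (\<exists>n. u = zigzag_raw 2 1 2 n)"
    and v: "v = Var 1 \<or> (\<exists>n. v = zigzag_raw 1 2 1 n)"
    by (elim B_inf_inhabitant)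
  \<comment> \<open>The innermost application of \<open>x\<close> to the bound variable is present
    even for \<open>n = 0\<close>.\<close>
  have raw: "lambda_I (zigzag_raw x y x n)" "free x (zigzag_raw x y x n)" for x y n
    by (auto simp: zigzag_raw_conv_chain free_chain intro!: lambda_I.intros lambda_I_chain)
  from u v have "lambda_I u" "free 2 u" "lambda_I v" "free 1 v"
    by (auto simp: raw intro: lambda_I.intros)
  then show "lambda_I t"
    unfolding t by (auto intro!: lambda_I.intros simp: numeral_2_eq_2)
qed

section \<open>Beta-eta-normal forms and the set of inhabitants\<close>

lemma not_beta_eta_Var: "\<not> beta_eta (Var i) t"
  by (simp add: beta_eta_def beta_Var eta_Var)

lemma beta_eta_normal_App:
  assumes "beta_eta_normal t" "beta_eta_normal u" "\<forall>s. t \<noteq> Lam s"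
  shows "beta_eta_normal (App t u)"
  using assms unfolding beta_eta_normal_def beta_eta_def
  by (auto elim!: beta.cases[of "App _ _"] eta.cases[of "App _ _"])

text \<open>The side condition is coarser than the absence of an eta-redex, but it avoids a test for
  free variables.\<close>

lemma beta_eta_normal_Lam:
  assumes "beta_eta_normal t" "\<forall>s. t \<noteq> App s (Var 0)"
  shows "beta_eta_normal (Lam t)"
  using assms unfolding beta_eta_normal_def beta_eta_def
  by (auto elim!: beta.cases[of "Lam _"] eta.cases[of "Lam _"])

lemma beta_eta_normal_Var: "beta_eta_normal (Var i)"
  by (simp add: beta_eta_normal_def not_beta_eta_Var)

lemma beta_eta_normal_chain: "beta_eta_normal w \<Longrightarrow> beta_eta_normal (chain p q n w)"
  by (induction n) (auto intro!: beta_eta_normal_App beta_eta_normal_Var)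

text \<open>For positive \<open>n\<close> the outermost argument is an application, not the bound
  variable, so the abstraction is no eta-redex.\<close>

lemma beta_eta_normal_zigzag: "beta_eta_normal (zigzag x y z n)"
proof (cases n)
  case (Suc m)
  have "beta_eta_normal (chain (Suc x) (Suc y) n (App (Var (Suc z)) (Var 0)))"
    by (intro beta_eta_normal_chain beta_eta_normal_App beta_eta_normal_Var) simp
  then show ?thesis
    using Suc by (auto simp: zigzag_cases zigzag_raw_conv_chain intro!: beta_eta_normal_Lam)
qed (simp add: zigzag_cases beta_eta_normal_Var)

lemma beta_eta_normal_LamD: "beta_eta_normal (Lam t) \<Longrightarrow> beta_eta_normal t"
  by (auto simp: beta_eta_normal_def beta_eta_def intro: beta_lam eta_lam)

lemma beta_eta_normal_AppD: "beta_eta_normal (App t u) \<Longrightarrow> beta_eta_normal t \<and> beta_eta_normal u"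
  by (auto simp: beta_eta_normal_def beta_eta_def intro: beta.intros eta.intros)

text \<open>The two forms differ only at \<open>n = 0\<close>, where the raw one is an
  eta-redex.\<close>

lemma beta_eta_normal_zigzag_raw:
  assumes "beta_eta_normal (zigzag_raw x y z n)"
  shows "zigzag_raw x y z n = zigzag x y z n"
proof (cases n)
  case 0
  have "eta (zigzag_raw x y z n) (Var z)"
    using 0 eta_redex[of "Var z"] by (simp add: zigzag_raw_def)
  with assms show ?thesis by (auto simp: beta_eta_normal_def beta_eta_def)
qed (simp add: zigzag_cases)

lemma typing_zigzag:
  assumes "\<forall>C\<in>set \<Gamma>. proper C" "x < length \<Gamma>" "y < length \<Gamma>" "\<Gamma> ! x = Fun A B" "\<Gamma> ! y = Fun B A"
  shows "\<Gamma> \<turnstile> zigzag x y x n : Fun A B"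
proof -
  \<comment> \<open>Needed for \<open>ax\<close> in the context enlarged by
    \<open>A\<close>.\<close>
  have pr: "proper A" using assms by (metis nth_mem proper.simps(2))
  have x: "A # \<Gamma> \<turnstile> Var (Suc x) : Fun A B" and y: "A # \<Gamma> \<turnstile> Var (Suc y) : Fun B A"
    and u: "A # \<Gamma> \<turnstile> Var 0 : A"
    using ax[of "A # \<Gamma>" "Suc x"] ax[of "A # \<Gamma>" "Suc y"] ax[of "A # \<Gamma>" 0] assms pr by auto
  have "\<Gamma> \<turnstile> zigzag_raw x y x n : Fun A B"
    unfolding zigzag_raw_conv_chain
    by (intro fun_intro typing_chain[OF x y] fun_elim[OF x u])
  moreover have "\<Gamma> \<turnstile> Var x : Fun A B" using ax[of \<Gamma> x] assms by simp
  ultimately show ?thesis by (simp add: zigzag_cases)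
qed

lemma T_in_Lambda: "T i j \<in> Lambda B_inf"
proof -
  have "closed (T i j)"
    by (auto simp: closed_def T_eq zigzag_cases zigzag_raw_conv_chain free_chain numeral_2_eq_2)
  moreover have "beta_eta_normal (T i j)"
  proof -
    \<comment> \<open>The second component is the last argument under the pair binder; were it
      \<open>Var 0\<close>, the side condition of \<open>beta_eta_normal_Lam\<close> would
      fail.\<close>
    have "zigzag 1 2 1 j \<noteq> Var 0" by (simp add: zigzag_cases zigzag_raw_def)
    then show ?thesis
      unfolding T_eq by (intro beta_eta_normal_Lam beta_eta_normal_App beta_eta_normal_Var
          beta_eta_normal_zigzag) auto
  qed
  moreover have "[] \<turnstile> T i j : B_inf"
  proof -
    have k: "B_ctx \<turnstile> Var 0 : hd B_ctx" using ax[of B_ctx 0] by simp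
    have "B_ctx \<turnstile> zigzag 2 1 2 i : Fun (TVar 2) (TVar 1)"
      "B_ctx \<turnstile> zigzag 1 2 1 j : Fun (TVar 1) (TVar 2)"
      by (rule typing_zigzag; simp)+
    with k have "B_ctx \<turnstile> App (App (Var 0) (zigzag 2 1 2 i)) (zigzag 1 2 1 j) : TVar 0"
      by (auto intro: fun_elim)
    then show ?thesis
      unfolding T_eq B_inf_eq
      by (auto intro!: all_intro fun_intro simp: numeral_2_eq_2)
  qed
  ultimately show ?thesis by (simp add: Lambda_def)
qed

lemma Lambda_B_inf: "Lambda B_inf = {T i j | i j. True}"
proof
  show "{T i j | i j. True} \<subseteq> Lambda B_inf" using T_in_Lambda by auto
  show "Lambda B_inf \<subseteq> {T i j | i j. True}"
  proof
    fix t assume t: "t \<in> Lambda B_inf"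
    then have "[] \<turnstile> t : B_inf" "beta_normal t" and n: "beta_eta_normal t"
      by (auto simp: Lambda_def beta_eta_normal_def beta_normal_def beta_eta_def)
    then obtain u v where eq: "t = Lam (Lam (Lam (App (App (Var 0) u) v)))"
      and u: "u = Var 2 \<or> (\<exists>n. u = zigzag_raw 2 1 2 n)"
      and v: "v = Var 1 \<or> (\<exists>n. v = zigzag_raw 1 2 1 n)"
      by (elim B_inf_inhabitant)
    have "beta_eta_normal u" "beta_eta_normal v"
      using n unfolding eq by (auto dest!: beta_eta_normal_LamD beta_eta_normal_AppD)
    \<comment> \<open>A bare variable is the zigzag of length 0; normality turns the raw forms into
      zigzags.\<close>
    with u v obtain i j where "u = zigzag 2 1 2 i" "v = zigzag 1 2 1 j"
      using beta_eta_normal_zigzag_raw zigzag_0 by metis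
    then show "t \<in> {T i j | i j. True}" using eq T_eq by auto
  qed
qed

theorem mainTheorem4:
  "infinite_I_type B_inf \<and> Lambda B_inf = {T i j | i j. True}"
proof -
  \<comment> \<open>One injective family of inhabitants suffices, so the second length is fixed at
    0.\<close>
  have "inj (\<lambda>i. T i 0)" by (auto simp: inj_def T_eq dest: zigzag_inj)
  then have "infinite (range (\<lambda>i. T i 0))" using finite_imageD infinite_UNIV_nat by blast
  moreover have "range (\<lambda>i. T i 0) \<subseteq> Lambda B_inf" using T_in_Lambda by auto
  ultimately have "infinite (Lambda B_inf)" using infinite_super by blast
  with I_type_B_inf Lambda_B_inf show ?thesis by (simp add: infinite_I_type_def)
qed

end
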